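(* The price of explainability for the maximum-spacing problem is $\Theta(n-k)$: there exist absolute constants $c,C>0$ such that for all integers $k\ge2$ and $n>k$, the price of explainability $\rho_{n,k}$ of the maximum-spacing problem satisfies $c\,(n-k)\le\rho_{n,k}\le C\,(n-k)$.
   Context: An instance of the maximum-spacing problem is a set $X\subset\mathbb{R}^d$ of $n$ (distinct) points, for some $d\ge1$. A $k$-clustering is a partition $\mathcal{C}=(C_1,\dots,C_k)$ of $X$ into $k$ nonempty groups; its spacing is $sp(\mathcal{C})=\min\{\|x-y\|_2: x \text{ and } y \text{ lie in distinct groups of }\mathcal{C}\}$, which is to be maximized. A standard decision tree is a binary tree in which each internal node $v$ is associated with a cut $(i_v,\theta_v)$, $i_v\in\{1,\dots,d\}$, $\theta_v\in\mathbb{R}$; the points reaching $v$ with $i_v$-th coordinate $\le\theta_v$ go to one child and those with $i_v$-th coordinate $>\theta_v$ go to the other. A $k$-clustering is explainable if it is the partition induced on $X$ by the leaves of a standard decision tree with $k$ leaves. $OPT_{unr}(X)$ is the maximum spacing over all $k$-clusterings of $X$, and $OPT_{exp}(X)$ is the maximum spacing over all explainable $k$-clusterings of $X$. The price of explainability is $\rho_{n,k}=\sup_X OPT_{unr}(X)/OPT_{exp}(X)$, the supremum being over all instances $X$ with $n$ points (in any dimension $d\ge1$). *)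

theory Defs
  imports "HOL-Analysis.Analysis" "HOL-Library.Disjoint_Sets"
begin

text \<open>
  The dimension varies inside the supremum defining the price of explainability, so a point of
  \<open>d\<close>-dimensional space is an extensional function on \<open>{1..d}\<close>.
\<close>

type_synonym point = "nat \<Rightarrow> real"

definition is_instance :: "nat \<Rightarrow> nat \<Rightarrow> point set \<Rightarrow> bool" where
  "is_instance n d X \<longleftrightarrow>
     1 \<le> d \<and> X \<subseteq> ({1..d} \<rightarrow>\<^sub>E (UNIV :: real set)) \<and> finite X \<and> card X = n"

definition euclid_dist :: "nat \<Rightarrow> point \<Rightarrow> point \<Rightarrow> real" where
  "euclid_dist d x y = L2_set (\<lambda>i. x i - y i) {1..d}"

definition is_clustering :: "nat \<Rightarrow> point set \<Rightarrow> point set set \<Rightarrow> bool" where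
  "is_clustering k X \<C> \<longleftrightarrow> partition_on X \<C> \<and> card \<C> = k"

definition spacing :: "nat \<Rightarrow> point set set \<Rightarrow> real" where
  "spacing d \<C> =
     Min {euclid_dist d x y | x y. \<exists>A\<in>\<C>. \<exists>B\<in>\<C>. A \<noteq> B \<and> x \<in> A \<and> y \<in> B}"

datatype dtree = Leaf | Node nat real dtree dtree

fun cuts_within :: "nat \<Rightarrow> dtree \<Rightarrow> bool" where
  "cuts_within d Leaf = True"
| "cuts_within d (Node i \<theta> l r) = (i \<in> {1..d} \<and> cuts_within d l \<and> cuts_within d r)"

fun leaf_groups :: "point set \<Rightarrow> dtree \<Rightarrow> point set list" where
  "leaf_groups X Leaf = [X]"
| "leaf_groups X (Node i \<theta> l r) =
     leaf_groups {x \<in> X. x i \<le> \<theta>} l @ leaf_groups {x \<in> X. x i > \<theta>} r"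

text \<open>
  A leaf reached by no point contributes the empty group, which \<open>partition_on\<close> excludes; so in an
  explainable \<open>k\<close>-clustering the \<open>k\<close> groups correspond one-to-one to the \<open>k\<close> leaves.
\<close>

definition explainable :: "nat \<Rightarrow> nat \<Rightarrow> point set \<Rightarrow> point set set \<Rightarrow> bool" where
  "explainable d k X \<C> \<longleftrightarrow> is_clustering k X \<C> \<and>
     (\<exists>t. cuts_within d t \<and> length (leaf_groups X t) = k \<and> set (leaf_groups X t) = \<C>)"

definition opt_unr :: "nat \<Rightarrow> nat \<Rightarrow> point set \<Rightarrow> real" where
  "opt_unr d k X = Max {spacing d \<C> | \<C>. is_clustering k X \<C>}"

definition opt_exp :: "nat \<Rightarrow> nat \<Rightarrow> point set \<Rightarrow> real" where
  "opt_exp d k X = Max {spacing d \<C> | \<C>. explainable d k X \<C>}"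

text \<open>
  For \<open>2 \<le> k < n\<close> the sets under \<open>Min\<close> and \<open>Max\<close> above are finite and nonempty, and
  \<open>opt_exp d k X\<close> is positive because the points are distinct.  The supremum is taken in the
  extended reals, so that its finiteness is part of any upper bound.
\<close>

definition price_of_explainability :: "nat \<Rightarrow> nat \<Rightarrow> ereal" where
  "price_of_explainability n k =
     Sup {ereal (opt_unr d k X / opt_exp d k X) | d X. is_instance n d X}"

end

theory Submission
  imports Defs
begin

text \<open>
  Upper bound, in any dimension: let \<open>W\<close> be the spacing of a \<open>k\<close>-clustering and call two points
  close if their distance is below \<open>r = W / (2(n - k))\<close>.  Close points share a cluster, so the
  closeness graph has at least \<open>k\<close> components and a spanning forest \<open>F\<close> with at most \<open>n - k\<close> edges.
  If no axis-parallel cut separates \<open>p\<close> from \<open>q\<close> without cutting an edge of \<open>F\<close>, then in every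
  coordinate the edges cover the interval between \<open>p\<close> and \<open>q\<close>, whence the distance of \<open>p\<close> and \<open>q\<close>
  is at most the total length of \<open>F\<close>, which is at most \<open>W / 2\<close>.  Hence a node that meets two clusters
  can always be cut without separating close points, and \<open>k\<close> leaves are reached with spacing at
  least \<open>r\<close>.

  Lower bound, with \<open>m = n - k\<close>: take the diagonal chain \<open>(t, t)\<close>, \<open>t = 0..m\<close>, and the points
  \<open>(j m, 0)\<close>, \<open>j = 1..k-1\<close>.  Separating all of the latter from the chain has spacing at least
  \<open>m / sqrt 2\<close>.  An explainable clustering of spacing above \<open>sqrt 2\<close> keeps the chain in one group, and
  this group then contains \<open>(m, 0)\<close>, a point of the bounding box of the chain; too few points
  remain for the other \<open>k - 1\<close> groups.
\<close>

lemma partition_on_same_group: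
  "partition_on X P \<Longrightarrow> A \<in> P \<Longrightarrow> x \<in> A \<Longrightarrow> B \<in> P \<Longrightarrow> x \<in> B \<Longrightarrow> A = B"
  using disjointD[OF partition_onD2] by blast

subsection \<open>Distances and spacings\<close>

lemma euclid_dist_commute: "euclid_dist d x y = euclid_dist d y x"
  by (simp add: euclid_dist_def L2_set_def power2_commute)

lemma euclid_dist_pos:
  assumes "x \<in> {1..d} \<rightarrow>\<^sub>E UNIV" "y \<in> {1..d} \<rightarrow>\<^sub>E UNIV" "x \<noteq> y"
  shows "euclid_dist d x y > 0"
proof -
  obtain i where "i \<in> {1..d}" "x i \<noteq> y i"
    using PiE_ext[OF assms(1,2)] assms(3) by blast
  then have "euclid_dist d x y \<noteq> 0"
    unfolding euclid_dist_def by (subst L2_set_eq_0_iff) auto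
  then show ?thesis
    by (simp add: euclid_dist_def order_less_le)
qed

lemma finite_spacing_set:
  assumes "finite X" "partition_on X \<C>"
  shows "finite {euclid_dist d x y | x y. \<exists>A\<in>\<C>. \<exists>B\<in>\<C>. A \<noteq> B \<and> x \<in> A \<and> y \<in> B}"
proof (rule finite_subset)
  show "{euclid_dist d x y | x y. \<exists>A\<in>\<C>. \<exists>B\<in>\<C>. A \<noteq> B \<and> x \<in> A \<and> y \<in> B}
      \<subseteq> (\<lambda>(x, y). euclid_dist d x y) ` (X \<times> X)"
    using partition_onD1[OF assms(2)] by force
  show "finite ((\<lambda>(x, y). euclid_dist d x y) ` (X \<times> X))"
    using assms(1) by simp
qed

lemma spacing_le:
  assumes "finite X" "partition_on X \<C>" "A \<in> \<C>" "B \<in> \<C>" "A \<noteq> B" "x \<in> A" "y \<in> B"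
  shows "spacing d \<C> \<le> euclid_dist d x y"
  unfolding spacing_def by (rule Min_le[OF finite_spacing_set[OF assms(1,2)]]) (use assms in blast)

text \<open>Two distinct groups, both nonempty, make the set under \<open>Min\<close> nonempty, so
  that a lower bound may be checked element by element.\<close>

lemma le_spacing:
  assumes "finite X" "partition_on X \<C>" "2 \<le> card \<C>"
    and "\<And>A B x y. A \<in> \<C> \<Longrightarrow> B \<in> \<C> \<Longrightarrow> A \<noteq> B \<Longrightarrow> x \<in> A \<Longrightarrow> y \<in> B \<Longrightarrow> r \<le> euclid_dist d x y"
  shows "r \<le> spacing d \<C>"
proof -
  obtain A B where AB: "A \<in> \<C>" "B \<in> \<C>" "A \<noteq> B"
    using assms(3) card_le_Suc0_iff_eq[of \<C>] card.infinite[of \<C>] by fastforce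
  then obtain x y where "x \<in> A" "y \<in> B"
    using partition_onD3[OF assms(2)] by (metis all_not_in_conv)
  with AB have "{euclid_dist d x y | x y. \<exists>A\<in>\<C>. \<exists>B\<in>\<C>. A \<noteq> B \<and> x \<in> A \<and> y \<in> B} \<noteq> {}"
    by blast
  then show ?thesis
    unfolding spacing_def using assms(4) by (subst Min_ge_iff[OF finite_spacing_set[OF assms(1,2)]]) auto
qed

text \<open>The distances between distinct points of a finite set have a positive minimum. This
  makes the threshold \<open>r\<close> of the upper bound positive and lets the optima be
  divided.\<close>

lemma spacing_pos:
  assumes "finite X" "X \<subseteq> {1..d} \<rightarrow>\<^sub>E UNIV" "partition_on X \<C>" "2 \<le> card \<C>"
  shows "spacing d \<C> > 0"
proof -
  let ?D = "{euclid_dist d x y | x y. x \<in> X \<and> y \<in> X \<and> x \<noteq> y}"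
  have "?D \<subseteq> (\<lambda>(x, y). euclid_dist d x y) ` (X \<times> X)" by auto
  \<comment> \<open>The extra element \<open>1\<close> guarantees that \<open>Min\<close> is taken
    over a nonempty set.\<close>
  then have fin: "finite (insert 1 ?D)"
    using assms(1) by (meson finite.insertI finite_SigmaI finite_imageI finite_subset)
  define e where "e = Min (insert 1 ?D)"
  have "e \<in> insert 1 ?D" unfolding e_def using fin by (intro Min_in) auto
  then consider "e = 1" | x y where "e = euclid_dist d x y" "x \<in> X" "y \<in> X" "x \<noteq> y" by blast
  then have "e > 0"
    using euclid_dist_pos subsetD[OF assms(2)] by cases auto
  also have "e \<le> spacing d \<C>"
  proof (rule le_spacing[OF assms(1,3,4)])
    fix A B x y assume *: "A \<in> \<C>" "B \<in> \<C>" "A \<noteq> B" "x \<in> A" "y \<in> B"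
    then have "x \<in> X" "y \<in> X" "x \<noteq> y"
      using partition_onD1[OF assms(3)] partition_on_same_group[OF assms(3)] by blast+
    then show "e \<le> euclid_dist d x y"
      unfolding e_def using fin by (intro Min_le) auto
  qed
  finally show ?thesis .
qed

section \<open>Finiteness and existence of clusterings\<close>

lemma finite_clusterings:
  assumes "finite X"
  shows "finite {spacing d \<C> | \<C>. is_clustering k X \<C>}"
proof -
  have "{\<C>. is_clustering k X \<C>} \<subseteq> Pow (Pow X)"
    using partition_onD1 unfolding is_clustering_def by blast
  then have "finite {\<C>. is_clustering k X \<C>}"
    using assms by (meson finite_Pow_iff finite_subset)
  then show ?thesis by (simp add: setcompr_eq_image)
qed

lemma finite_explainable:
  assumes "finite X"
  shows "finite {spacing d \<C> | \<C>. explainable d k X \<C>}"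
  by (rule finite_subset[OF _ finite_clusterings[OF assms, of d k]]) (auto simp: explainable_def)

text \<open>Properness of the inclusion keeps the remaining group \<open>X - Y\<close> nonempty. The
  construction shows that \<open>k\<close>-clusterings exist and later isolates the outliers of the
  lower bound.\<close>

lemma is_clustering_singletons:
  assumes "finite X" "Y \<subset> X"
  shows "is_clustering (Suc (card Y)) X (insert (X - Y) ((\<lambda>x. {x}) ` Y))"
proof -
  have "X - Y \<notin> (\<lambda>x. {x}) ` Y" by auto
  moreover have "card ((\<lambda>x. {x}) ` Y) = card Y" by (simp add: card_image)
  moreover have "finite Y" using assms finite_subset by blast
  ultimately have "card (insert (X - Y) ((\<lambda>x. {x}) ` Y)) = Suc (card Y)" by simp
  moreover have "partition_on X (insert (X - Y) ((\<lambda>x. {x}) ` Y))"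
    using assms(2) by (intro partition_onI) (auto simp: disjnt_def)
  ultimately show ?thesis by (simp add: is_clustering_def)
qed

lemma ex_clustering:
  assumes "finite X" "1 \<le> k" "k \<le> card X"
  shows "\<exists>\<C>. is_clustering k X \<C>"
proof -
  obtain Y where Y: "Y \<subseteq> X" "card Y = k - 1"
    using assms(3) obtain_subset_with_card_n[of "k - 1" X] by (metis diff_le_self order_trans)
  then have "Y \<subset> X" using assms(2,3) by force
  from is_clustering_singletons[OF assms(1) this] have "\<exists>\<C>. is_clustering (Suc (card Y)) X \<C>"
    by (rule exI)
  then show ?thesis using Y(2) assms(2) by simp
qed

subsection \<open>Leaves of decision trees\<close>

text \<open>The two sides of a cut are disjoint, so two leaves could carry the same group only if it
  were empty. Distinctness turns the number of leaves into the number of groups.\<close>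

lemma leaf_groups_partition:
  assumes "{} \<notin> set (leaf_groups X t)"
  shows "partition_on X (set (leaf_groups X t)) \<and> distinct (leaf_groups X t)"
  using assms
proof (induction t arbitrary: X)
  case Leaf
  then show ?case by (auto simp: partition_on_def)
next
  case (Node i \<theta> l r)
  let ?L = "{x \<in> X. x i \<le> \<theta>}" and ?R = "{x \<in> X. x i > \<theta>}"
  have l: "partition_on ?L (set (leaf_groups ?L l))" "distinct (leaf_groups ?L l)"
    and r: "partition_on ?R (set (leaf_groups ?R r))" "distinct (leaf_groups ?R r)"
    using Node.IH(1)[of ?L] Node.IH(2)[of ?R] Node.prems by auto
  have L: "A \<subseteq> ?L" if "A \<in> set (leaf_groups ?L l)" for A
    using partition_onD1[OF l(1)] that by blast
  have R: "A \<subseteq> ?R" if "A \<in> set (leaf_groups ?R r)" for A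
    using partition_onD1[OF r(1)] that by blast
  have disj: "A \<inter> B = {}" if "A \<in> set (leaf_groups ?L l)" "B \<in> set (leaf_groups ?R r)" for A B
  proof -
    have "A \<inter> B \<subseteq> ?L \<inter> ?R" using L[OF that(1)] R[OF that(2)] by (rule Int_mono)
    also have "\<dots> = {}" by auto
    finally show ?thesis by simp
  qed
  have "A \<notin> set (leaf_groups ?R r)" if "A \<in> set (leaf_groups ?L l)" for A
  proof
    assume "A \<in> set (leaf_groups ?R r)"
    from disj[OF that this] have "A = {}" by simp
    with that partition_onD3[OF l(1)] show False by simp
  qed
  then have "distinct (leaf_groups X (Node i \<theta> l r))"
    using l(2) r(2) by (simp add: disjoint_iff)
  moreover have "partition_on X (set (leaf_groups X (Node i \<theta> l r)))"
  proof (rule partition_onI)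
    have "X = ?L \<union> ?R" by auto
    then show "\<Union> (set (leaf_groups X (Node i \<theta> l r))) = X"
      using partition_onD1[OF l(1)] partition_onD1[OF r(1)] by simp
    show "disjnt A B" if "A \<in> set (leaf_groups X (Node i \<theta> l r))"
        "B \<in> set (leaf_groups X (Node i \<theta> l r))" "A \<noteq> B" for A B
      using that disj[of A B] disj[of B A] disjointD[OF partition_onD2[OF l(1)], of A B]
        disjointD[OF partition_onD2[OF r(1)], of A B]
      by (auto simp: disjnt_def)
  qed (use Node.prems in auto)
  ultimately show ?case by blast
qed

text \<open>A leaf collects the points of an axis-parallel box: a cut with \<open>p\<close> and
  \<open>q\<close> on one side has every point between them, coordinate by coordinate, on that side
  too. This is the obstruction behind the lower bound.\<close>

lemma leaf_groups_box:
  assumes "cuts_within d t" "A \<in> set (leaf_groups X t)" "p \<in> A" "q \<in> A" "b \<in> X"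
    and "\<And>i. i \<in> {1..d} \<Longrightarrow> min (p i) (q i) \<le> b i \<and> b i \<le> max (p i) (q i)"
  shows "b \<in> A"
  using assms
proof (induction t arbitrary: X)
  case (Node i \<theta> l r)
  have sub: "A \<subseteq> X" if "A \<in> set (leaf_groups X t)" for A X t
    using that by (induction t arbitrary: X) fastforce+
  have i: "min (p i) (q i) \<le> b i" "b i \<le> max (p i) (q i)"
    using Node.prems(1,6) by auto
  consider "A \<in> set (leaf_groups {x \<in> X. x i \<le> \<theta>} l)" | "A \<in> set (leaf_groups {x \<in> X. x i > \<theta>} r)"
    using Node.prems by auto
  then show ?case
  proof cases
    case 1
    with sub Node.prems have "p i \<le> \<theta>" "q i \<le> \<theta>" by blast+
    then have "b i \<le> \<theta>" using i(2) by linarith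
    with Node.prems have "b \<in> {x \<in> X. x i \<le> \<theta>}" by simp
    from Node.IH(1)[OF _ 1 Node.prems(3,4) this] Node.prems(1,6) show ?thesis by simp
  next
    case 2
    with sub Node.prems have "p i > \<theta>" "q i > \<theta>" by blast+
    then have "b i > \<theta>" using i(1) by linarith
    with Node.prems have "b \<in> {x \<in> X. x i > \<theta>}" by simp
    from Node.IH(2)[OF _ 2 Node.prems(3,4) this] Node.prems(1,6) show ?thesis by simp
  qed
qed auto

subsection \<open>Spanning forests and uncut edges\<close>

text \<open>Such a set is a union of connected components of the graph \<open>F\<close>; this form
  avoids paths.\<close>

definition edge_closed :: "('a \<times> 'a) set \<Rightarrow> 'a set \<Rightarrow> bool" where
  "edge_closed F S \<longleftrightarrow> (\<forall>(u, v)\<in>F. u \<in> S \<longleftrightarrow> v \<in> S)"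

text \<open>The map \<open>f\<close> labels the connected components; the last equation says that \<open>F\<close> is a forest.\<close>

lemma ex_spanning_forest:
  fixes X :: "'a set"
  assumes "finite R" "finite X" "R \<subseteq> X \<times> X"
  shows "\<exists>F (f :: 'a \<Rightarrow> 'a). F \<subseteq> R \<and> (\<forall>(u, v)\<in>R. f u = f v) \<and>
    (\<forall>S x y. edge_closed F S \<longrightarrow> f x = f y \<longrightarrow> (x \<in> S \<longleftrightarrow> y \<in> S)) \<and>
    card F + card (f ` X) = card X"
  using assms(1,3)
proof (induction R rule: finite_induct)
  case empty
  show ?case by (rule exI[of _ "{}"], rule exI[of _ id]) auto
next
  case (insert e R)
  obtain u v where e: "e = (u, v)" by fastforce
  obtain F and f :: "'a \<Rightarrow> 'a" where F: "F \<subseteq> R" "\<forall>(u, v)\<in>R. f u = f v"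
      "\<And>S x y. edge_closed F S \<Longrightarrow> f x = f y \<Longrightarrow> (x \<in> S \<longleftrightarrow> y \<in> S)"
      "card F + card (f ` X) = card X"
  proof -
    have "R \<subseteq> X \<times> X" using insert.prems by blast
    from insert.IH[OF this] show thesis using that by blast
  qed
  \<comment> \<open>Kruskal's step: an edge inside a component is discarded, an edge between two
    components is added and merges them.\<close>
  show ?case
  proof (cases "f u = f v")
    case True
    with F(2) e have "\<forall>(a, b)\<in>insert e R. f a = f b" by simp
    with F(1,3,4) show ?thesis by blast
  next
    case False
    \<comment> \<open>The component of \<open>v\<close> takes over the label of \<open>u\<close>, so
      exactly the label \<open>f v\<close> disappears.\<close>
    define g where "g = (\<lambda>z. if f z = f v then f u else f z)"
    have X: "u \<in> X" "v \<in> X" using insert.prems e by auto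
    have "g ` X = f ` X - {f v}"
      using X False by (auto simp: g_def image_iff)
    then have "Suc (card (g ` X)) = card (f ` X)"
      using X assms(2) by (metis card_Suc_Diff1 finite_imageI imageI)
    moreover have "e \<notin> F" "finite F"
      using F(1) insert.hyps finite_subset by blast+
    ultimately have card: "card (insert e F) + card (g ` X) = card X"
      using F(4) by simp
    \<comment> \<open>A relabelled point agrees with \<open>v\<close> on membership in
      \<open>S\<close>, and through the new edge also with \<open>u\<close>.\<close>
    have "x \<in> S \<longleftrightarrow> y \<in> S" if "edge_closed (insert e F) S" "g x = g y" for S x y
    proof -
      have "edge_closed F S" "u \<in> S \<longleftrightarrow> v \<in> S"
        using that(1) e by (auto simp: edge_closed_def)
      with that(2) show ?thesis
        using F(3)[of S x y] F(3)[of S x u] F(3)[of S x v] F(3)[of S y u] F(3)[of S y v]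
        unfolding g_def by (auto split: if_splits)
    qed
    moreover have "\<forall>(a, b)\<in>insert e R. g a = g b"
      using F(2) e by (auto simp: g_def)
    moreover have "insert e F \<subseteq> insert e R" using F(1) by blast
    ultimately show ?thesis using card by blast
  qed
qed

section \<open>Cuts that avoid all edges\<close>

text \<open>Subadditivity of Lebesgue measure. Half-open intervals match the cuts: a threshold
  separates two coordinates exactly if it is at least the smaller and below the larger one.\<close>

lemma interval_cover_length:
  fixes a b :: real
  assumes "finite F" "a \<le> b" "\<And>e. e \<in> F \<Longrightarrow> lo e \<le> hi e"
    and "{a..<b} \<subseteq> (\<Union>e\<in>F. {lo e..<hi e})"
  shows "b - a \<le> (\<Sum>e\<in>F. hi e - lo e)"
proof -
  have "b - a = measure lborel {a..<b}" using assms(2) by simp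
  also have "\<dots> \<le> measure lborel (\<Union>e\<in>F. {lo e..<hi e})"
    using assms by (intro measure_mono_fmeasurable fmeasurable.finite_UN) (auto simp: fmeasurable_def)
  also have "\<dots> \<le> (\<Sum>e\<in>F. measure lborel {lo e..<hi e})"
    using assms by (intro measure_UNION_le) auto
  also have "\<dots> = (\<Sum>e\<in>F. hi e - lo e)"
    using assms(3) by (intro sum.cong) auto
  finally show ?thesis .
qed

text \<open>Minkowski's inequality for finite sums; it turns coordinatewise bounds into a bound by
  the total edge length, with no factor depending on the dimension.\<close>

lemma L2_set_sum_le:
  assumes "finite F"
  shows "L2_set (\<lambda>i. \<Sum>e\<in>F. f e i) I \<le> (\<Sum>e\<in>F. L2_set (f e) I)"
  using assms
proof (induction F rule: finite_induct)
  case empty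
  show ?case by (simp add: L2_set_def)
next
  case (insert e F)
  then show ?case
    using L2_set_triangle_ineq[of "f e" "\<lambda>i. \<Sum>e\<in>F. f e i" I] by simp
qed

text \<open>Otherwise every threshold between \<open>p\<close> and \<open>q\<close>, in every
  coordinate, would split an edge, so the projected edges would cover the projected segment and
  their total length would be too large.\<close>

lemma ex_cut_edge_closed:
  assumes "finite F" "edge_closed F S" "p \<in> S" "q \<in> S"
    and less: "(\<Sum>(u, v)\<in>F. euclid_dist d u v) < euclid_dist d p q"
  shows "\<exists>i\<in>{1..d}. \<exists>\<theta>. {x \<in> S. x i \<le> \<theta>} \<noteq> {} \<and> {x \<in> S. x i > \<theta>} \<noteq> {} \<and>
    edge_closed F {x \<in> S. x i \<le> \<theta>} \<and> edge_closed F {x \<in> S. x i > \<theta>}"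
proof (rule ccontr)
  assume neg: "\<not> ?thesis"
  have "\<bar>p i - q i\<bar> \<le> (\<Sum>(u, v)\<in>F. \<bar>u i - v i\<bar>)" if i: "i \<in> {1..d}" for i
  proof -
    let ?lo = "\<lambda>(u, v). min (u i) (v i)" and ?hi = "\<lambda>(u, v). max (u i) (v i)"
    have "{min (p i) (q i)..<max (p i) (q i)} \<subseteq> (\<Union>e\<in>F. {?lo e..<?hi e})"
    proof
      fix \<theta> assume \<theta>: "\<theta> \<in> {min (p i) (q i)..<max (p i) (q i)}"
      then have "{x \<in> S. x i \<le> \<theta>} \<noteq> {}" "{x \<in> S. x i > \<theta>} \<noteq> {}"
        using assms(3,4) by (auto simp: min_def max_def split: if_splits)
      then have "\<not> (edge_closed F {x \<in> S. x i \<le> \<theta>} \<and> edge_closed F {x \<in> S. x i > \<theta>})"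
        using neg i by blast
      \<comment> \<open>As \<open>S\<close> is itself edge closed, a violating edge has both ends in
        \<open>S\<close> and is split by the threshold.\<close>
      then obtain u v where "(u, v) \<in> F" "(u i \<le> \<theta>) \<noteq> (v i \<le> \<theta>)"
        using assms(2) unfolding edge_closed_def by fastforce
      then show "\<theta> \<in> (\<Union>e\<in>F. {?lo e..<?hi e})"
        by (intro UN_I[of "(u, v)"]) auto
    qed
    then have "max (p i) (q i) - min (p i) (q i) \<le> (\<Sum>e\<in>F. ?hi e - ?lo e)"
      by (intro interval_cover_length assms(1)) auto
    also have "(\<Sum>e\<in>F. ?hi e - ?lo e) = (\<Sum>(u, v)\<in>F. \<bar>u i - v i\<bar>)"
      by (intro sum.cong) (auto simp: max_def min_def)
    finally show ?thesis by (simp add: max_def min_def split: if_splits)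
  qed
  then have "L2_set (\<lambda>i. \<bar>p i - q i\<bar>) {1..d} \<le> L2_set (\<lambda>i. \<Sum>(u, v)\<in>F. \<bar>u i - v i\<bar>) {1..d}"
    by (intro L2_set_mono) auto
  also have "\<dots> \<le> (\<Sum>(u, v)\<in>F. L2_set (\<lambda>i. \<bar>u i - v i\<bar>) {1..d})"
    using L2_set_sum_le[OF assms(1), of "\<lambda>(u, v) i. \<bar>u i - v i\<bar>" "{1..d}"]
    by (simp add: case_prod_unfold)
  finally show False
    using less by (simp add: euclid_dist_def L2_set_def)
qed

text \<open>Here \<open>g\<close> maps a point to its cluster.\<close>

lemma ex_tree_edge_closed:
  fixes g :: "point \<Rightarrow> 'b"
  assumes "finite F" "finite S" "S \<subseteq> X" "edge_closed F S" "1 \<le> j" "j \<le> card (g ` S)"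
    and far: "\<And>p q. p \<in> X \<Longrightarrow> q \<in> X \<Longrightarrow> g p \<noteq> g q \<Longrightarrow>
      (\<Sum>(u, v)\<in>F. euclid_dist d u v) < euclid_dist d p q"
  shows "\<exists>t. cuts_within d t \<and> length (leaf_groups S t) = j \<and>
    (\<forall>A\<in>set (leaf_groups S t). A \<noteq> {} \<and> edge_closed F A)"
  using assms(2-6)
proof (induction S arbitrary: j rule: finite_psubset_induct)
  case (psubset S)
  have "S \<noteq> {}" using psubset.prems(3,4) by auto
  show ?case
  proof (cases "j = 1")
    case True
    with psubset.prems \<open>S \<noteq> {}\<close> show ?thesis by (intro exI[of _ Leaf]) auto
  next
    case False
    then have "\<not> card (g ` S) \<le> Suc 0" using psubset.prems by linarith
    then obtain p q where pq: "p \<in> S" "q \<in> S" "g p \<noteq> g q"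
      using card_le_Suc0_iff_eq[of "g ` S"] psubset.hyps by auto
    then have "p \<in> X" "q \<in> X" using psubset.prems(1) by blast+
    from ex_cut_edge_closed[OF assms(1) psubset.prems(2) pq(1,2) far[OF this pq(3)]]
    obtain i \<theta> where i: "i \<in> {1..d}" and
      ne: "{x \<in> S. x i \<le> \<theta>} \<noteq> {}" "{x \<in> S. x i > \<theta>} \<noteq> {}" and
      cl: "edge_closed F {x \<in> S. x i \<le> \<theta>}" "edge_closed F {x \<in> S. x i > \<theta>}"
      by (elim bexE exE conjE) (rule that)
    let ?L = "{x \<in> S. x i \<le> \<theta>}" and ?R = "{x \<in> S. x i > \<theta>}"
    have split: "S = ?L \<union> ?R" "?L \<inter> ?R = {}" by auto
    then have sub: "?L \<subset> S" "?R \<subset> S" "?L \<subseteq> X" "?R \<subseteq> X"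
      using ne psubset.prems(1) by blast+
    \<comment> \<open>A cluster may meet both sides of the cut; it is then counted twice, which only
      helps.\<close>
    have "g ` S = g ` ?L \<union> g ` ?R" using split(1) by (metis image_Un)
    then have "j \<le> card (g ` ?L) + card (g ` ?R)"
      using psubset.prems(4) card_Un_le[of "g ` ?L" "g ` ?R"] by simp
    moreover have "1 \<le> card (g ` ?L)" "1 \<le> card (g ` ?R)"
      using ne psubset.hyps by (simp_all add: Suc_le_eq card_gt_0_iff)
    \<comment> \<open>The left subtree gets one leaf per cluster it meets, capped so that at least
      one of the \<open>j\<close> leaves is left for the right subtree.\<close>
    moreover define a where "a = min (card (g ` ?L)) (j - 1)"
    ultimately have a: "1 \<le> a" "a \<le> card (g ` ?L)" "1 \<le> j - a" "j - a \<le> card (g ` ?R)" "a \<le> j"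
      using False psubset.prems(3) by linarith+
    obtain l where l: "cuts_within d l" "length (leaf_groups ?L l) = a"
        "\<forall>A\<in>set (leaf_groups ?L l). A \<noteq> {} \<and> edge_closed F A"
      using psubset.IH[OF sub(1,3) cl(1) a(1,2)] by blast
    obtain r where r: "cuts_within d r" "length (leaf_groups ?R r) = j - a"
        "\<forall>A\<in>set (leaf_groups ?R r). A \<noteq> {} \<and> edge_closed F A"
      using psubset.IH[OF sub(2,4) cl(2) a(3,4)] by blast
    show ?thesis
      using l r i a(5) by (intro exI[of _ "Node i \<theta> l r"]) auto
  qed
qed

subsection \<open>Upper bound\<close>

text \<open>Leaf groups that are unions of closeness components lie at distance at least
  \<open>r\<close> from each other; the tree exists because the whole forest is shorter than
  \<open>W\<close>.\<close>

lemma ex_explainable_spacing: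
  assumes inst: "is_instance n d X" and "2 \<le> k" "k < n" and clus: "is_clustering k X \<C>"
  shows "\<exists>\<D>. explainable d k X \<D> \<and> spacing d \<C> / (2 * (real n - real k)) \<le> spacing d \<D>"
proof -
  have X: "finite X" "X \<subseteq> {1..d} \<rightarrow>\<^sub>E UNIV" "card X = n"
    using inst by (auto simp: is_instance_def)
  have part: "partition_on X \<C>" and card: "card \<C> = k"
    using clus by (auto simp: is_clustering_def)
  define W where "W = spacing d \<C>"
  have "W > 0" using spacing_pos[OF X(1,2) part] card assms(2) by (simp add: W_def)
  \<comment> \<open>The factor \<open>2\<close> leaves room: \<open>n - k\<close> edges shorter than
    \<open>r\<close> have total length at most \<open>W / 2\<close>, and \<open>r\<close> itself is
    below \<open>W\<close>.\<close>
  define r where "r = W / (2 * (real n - real k))"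
  have nk: "real n - real k \<ge> 1" using assms(3) by linarith
  have "r > 0" using \<open>W > 0\<close> nk by (simp add: r_def)
  have "(real n - real k) * r = W / 2" using nk by (simp add: r_def field_simps)
  then have rW: "(real n - real k) * r < W" using \<open>W > 0\<close> by simp
  then have "r < W" using mult_right_mono[OF nk, of r] \<open>r > 0\<close> by linarith
  define R where "R = {(u, v) \<in> X \<times> X. euclid_dist d u v < r}"
  have R: "R \<subseteq> X \<times> X" "finite R"
    using X(1) finite_subset[of R "X \<times> X"] by (auto simp: R_def)
  obtain F and f :: "point \<Rightarrow> point" where F: "F \<subseteq> R" "\<And>u v. (u, v) \<in> R \<Longrightarrow> f u = f v"
      "\<And>S x y. edge_closed F S \<Longrightarrow> f x = f y \<Longrightarrow> (x \<in> S \<longleftrightarrow> y \<in> S)"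
      "card F + card (f ` X) = card X"
    using ex_spanning_forest[OF R(2) X(1) R(1)] by blast
  have "finite F" using F(1) R(2) finite_subset by blast
  have "\<forall>x\<in>X. \<exists>A\<in>\<C>. x \<in> A" using partition_onD1[OF part] by blast
  then obtain g where g: "\<And>x. x \<in> X \<Longrightarrow> g x \<in> \<C> \<and> x \<in> g x" by metis
  have far: "W \<le> euclid_dist d x y" if "x \<in> X" "y \<in> X" "g x \<noteq> g y" for x y
    unfolding W_def using that g by (intro spacing_le[OF X(1) part, of "g x" "g y"]) auto
  have gX: "g ` X = \<C>"
  proof
    show "\<C> \<subseteq> g ` X"
    proof
      fix A assume "A \<in> \<C>"
      then obtain x where x: "x \<in> A" using partition_onD3[OF part] by fastforce
      then have "x \<in> X" using \<open>A \<in> \<C>\<close> partition_onD1[OF part] by blast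
      then have "g x = A" using g x \<open>A \<in> \<C>\<close> partition_on_same_group[OF part] by blast
      with \<open>x \<in> X\<close> show "A \<in> g ` X" by blast
    qed
  qed (use g in blast)
  \<comment> \<open>Components stay inside clusters: an edge is shorter than \<open>W\<close>, so
    each cluster is edge closed.\<close>
  have same: "g x = g y" if "x \<in> X" "y \<in> X" "f x = f y" for x y
  proof -
    have "g u = g v" if "u \<in> X" "v \<in> X" "euclid_dist d u v < r" for u v
      using far[OF that(1,2)] that(3) \<open>r < W\<close> by fastforce
    then have "edge_closed F {z \<in> X. g z = g x}"
      using F(1) by (auto simp: edge_closed_def R_def)
    then show ?thesis using F(3)[of "{z \<in> X. g z = g x}" x y] that by simp
  qed
  \<comment> \<open>The cluster map factors through the component labels, so there are at least
    \<open>k\<close> components and at most \<open>n - k\<close> forest edges.\<close>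
  have "g x = g (inv_into X f (f x))" if "x \<in> X" for x
    using that by (intro same) (simp_all add: inv_into_into f_inv_into_f)
  then have "g ` X = (\<lambda>l. g (inv_into X f l)) ` f ` X"
    unfolding image_image by (intro image_cong refl)
  then have "k \<le> card (f ` X)"
    using card gX card_image_le[of "f ` X" "\<lambda>l. g (inv_into X f l)"] X(1) by simp
  then have cF: "real (card F) \<le> real n - real k" using F(4) X(3) by linarith
  have "(\<Sum>(u, v)\<in>F. euclid_dist d u v) \<le> (\<Sum>(u, v)\<in>F. r)"
    using F(1) by (intro sum_mono) (auto simp: R_def)
  also have "\<dots> = real (card F) * r" by (simp add: case_prod_unfold)
  also have "\<dots> \<le> (real n - real k) * r" using cF \<open>r > 0\<close> by (intro mult_right_mono) auto
  also have "\<dots> < W" by (rule rW)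
  finally have len: "(\<Sum>(u, v)\<in>F. euclid_dist d u v) < W" .
  have "edge_closed F X" using F(1) R(1) by (auto simp: edge_closed_def)
  moreover have "(\<Sum>(u, v)\<in>F. euclid_dist d u v) < euclid_dist d x y"
    if "x \<in> X" "y \<in> X" "g x \<noteq> g y" for x y
    using far[OF that] len by linarith
  ultimately have "\<exists>t. cuts_within d t \<and> length (leaf_groups X t) = k \<and>
      (\<forall>A\<in>set (leaf_groups X t). A \<noteq> {} \<and> edge_closed F A)"
    using gX card assms(2) by (intro ex_tree_edge_closed[OF \<open>finite F\<close> X(1) order_refl]) auto
  then obtain t where t: "cuts_within d t" "length (leaf_groups X t) = k"
      "\<And>A. A \<in> set (leaf_groups X t) \<Longrightarrow> A \<noteq> {} \<and> edge_closed F A"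
    by blast
  let ?D = "set (leaf_groups X t)"
  have pD: "partition_on X ?D" and cD: "card ?D = k"
    using leaf_groups_partition[of X t] t(2,3) distinct_card by auto
  have "r \<le> spacing d ?D"
  proof (rule le_spacing[OF X(1) pD])
    fix A B x y assume *: "A \<in> ?D" "B \<in> ?D" "A \<noteq> B" "x \<in> A" "y \<in> B"
    then have "x \<in> X" "y \<in> X" "y \<notin> A"
      using partition_onD1[OF pD] partition_on_same_group[OF pD] by blast+
    \<comment> \<open>Close points carry the same label, so the edge-closed group \<open>A\<close>
      could not contain only one of them.\<close>
    then have "(x, y) \<notin> R"
      using * F(2) F(3)[of A x y] t(3) by blast
    then show "r \<le> euclid_dist d x y"
      using \<open>x \<in> X\<close> \<open>y \<in> X\<close> by (auto simp: R_def)
  qed (use cD assms(2) in simp)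
  moreover have "explainable d k X ?D"
    using pD cD t unfolding explainable_def is_clustering_def by blast
  ultimately show ?thesis unfolding r_def W_def by blast
qed

text \<open>The maximum \<open>opt_unr\<close> is attained, so the comparison can be applied to an
  optimal clustering.\<close>

lemma opt_bounds:
  assumes inst: "is_instance n d X" and "2 \<le> k" "k < n"
  shows "0 < opt_exp d k X" "opt_unr d k X \<le> 2 * (real n - real k) * opt_exp d k X"
proof -
  have X: "finite X" "X \<subseteq> {1..d} \<rightarrow>\<^sub>E UNIV" "card X = n"
    using inst by (auto simp: is_instance_def)
  have "\<exists>\<C>. is_clustering k X \<C>"
    using ex_clustering[OF X(1), of k] X(3) assms(2,3) by simp
  then have "opt_unr d k X \<in> {spacing d \<C> | \<C>. is_clustering k X \<C>}"
    unfolding opt_unr_def by (intro Max_in finite_clusterings X(1)) auto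
  then obtain \<C> where \<C>: "is_clustering k X \<C>" "opt_unr d k X = spacing d \<C>" by blast
  obtain \<D> where \<D>: "explainable d k X \<D>" "spacing d \<C> / (2 * (real n - real k)) \<le> spacing d \<D>"
    using ex_explainable_spacing[OF assms \<C>(1)] by blast
  have le: "spacing d \<D> \<le> opt_exp d k X"
    unfolding opt_exp_def using \<D>(1) by (intro Max_ge finite_explainable X(1)) auto
  have "spacing d \<D> > 0"
    using spacing_pos[OF X(1,2)] \<D>(1) assms(2) by (auto simp: explainable_def is_clustering_def)
  with le show "0 < opt_exp d k X" by linarith
  have "real n - real k > 0" using assms(3) by simp
  then have "opt_unr d k X \<le> 2 * (real n - real k) * spacing d \<D>"
    using \<D>(2) \<C>(2) by (simp add: field_simps)
  also have "\<dots> \<le> 2 * (real n - real k) * opt_exp d k X"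
    using le \<open>real n - real k > 0\<close> by (intro mult_left_mono) auto
  finally show "opt_unr d k X \<le> 2 * (real n - real k) * opt_exp d k X" .
qed

subsection \<open>Lower bound\<close>

text \<open>The restriction to \<open>{1..2}\<close> makes the point extensional, as
  \<open>is_instance\<close> demands.\<close>

definition plane_point :: "real \<Rightarrow> real \<Rightarrow> point" where
  "plane_point a b = (\<lambda>i\<in>{1..2}. if i = 1 then a else b)"

lemma plane_point_eq_iff [simp]: "plane_point a b = plane_point a' b' \<longleftrightarrow> a = a' \<and> b = b'"
proof
  assume "plane_point a b = plane_point a' b'"
  from fun_cong[OF this, of 1] fun_cong[OF this, of 2] show "a = a' \<and> b = b'"
    by (simp add: plane_point_def)
qed simp

lemma euclid_dist_plane_point:
  "euclid_dist 2 (plane_point a b) (plane_point a' b') = sqrt ((a - a')\<^sup>2 + (b - b')\<^sup>2)"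
proof -
  have "{1..2::nat} = {1, 2}" by auto
  then show ?thesis by (simp add: euclid_dist_def L2_set_def plane_point_def)
qed

definition chain :: "nat \<Rightarrow> point set" where
  "chain m = (\<lambda>t. plane_point (real t) (real t)) ` {0..m}"

text \<open>The outlier with \<open>j = 1\<close> is a corner of the bounding box of the chain. With
  the \<open>m + 1\<close> chain points the total is \<open>m + k\<close>.\<close>

definition outliers :: "nat \<Rightarrow> nat \<Rightarrow> point set" where
  "outliers m k = (\<lambda>j. plane_point (real j * real m) 0) ` {1..k - 1}"

lemma card_chain: "card (chain m) = Suc m"
  unfolding chain_def by (subst card_image) (auto intro: inj_onI)

lemma card_outliers: "m \<ge> 1 \<Longrightarrow> card (outliers m k) = k - 1"
  unfolding outliers_def by (subst card_image) (auto intro: inj_onI)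

lemma chain_outliers_disjoint: "m \<ge> 1 \<Longrightarrow> chain m \<inter> outliers m k = {}"
  by (auto simp: chain_def outliers_def)

lemma is_instance_chain_outliers:
  assumes "m \<ge> 1" "k \<ge> 2"
  shows "is_instance (m + k) 2 (chain m \<union> outliers m k)"
proof -
  have "card (chain m \<union> outliers m k) = m + k"
    using card_chain card_outliers chain_outliers_disjoint assms
    by (subst card_Un_disjoint) (auto simp: chain_def outliers_def)
  then show ?thesis
    by (auto simp: is_instance_def chain_def outliers_def plane_point_def)
qed

lemma outlier_dist_chain:
  assumes "p \<in> chain m" "q \<in> outliers m k"
  shows "real m / sqrt 2 \<le> euclid_dist 2 q p"
proof -
  obtain t j where t: "t \<le> m" "p = plane_point (real t) (real t)"
    and j: "1 \<le> j" "q = plane_point (real j * real m) 0"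
    using assms by (auto simp: chain_def outliers_def)
  have "real m \<le> real j * real m" using j(1) by (cases "m = 0") auto
  then have "(real m - real t)\<^sup>2 \<le> (real j * real m - real t)\<^sup>2"
    using t(1) by (intro power_mono) auto
  \<comment> \<open>Twice the difference of the two sides is the square of \<open>m - 2 * t\<close>;
    geometrically, \<open>m / sqrt 2\<close> is the distance of the corner from the
    diagonal.\<close>
  moreover have "(real m)\<^sup>2 / 2 \<le> (real m - real t)\<^sup>2 + (real t)\<^sup>2"
    using zero_le_power2[of "real m - 2 * real t"] by (simp add: power2_eq_square algebra_simps)
  ultimately have "(real m)\<^sup>2 / 2 \<le> (real j * real m - real t)\<^sup>2 + (0 - real t)\<^sup>2" by simp
  then have "sqrt ((real m)\<^sup>2 / 2) \<le> euclid_dist 2 q p"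
    unfolding t j euclid_dist_plane_point by (rule real_sqrt_le_mono)
  then show ?thesis by (simp add: real_sqrt_divide)
qed

lemma outlier_dist_outlier:
  assumes "p \<in> outliers m k" "q \<in> outliers m k" "p \<noteq> q"
  shows "real m \<le> euclid_dist 2 p q"
proof -
  obtain i j where *: "p = plane_point (real i * real m) 0" "q = plane_point (real j * real m) 0"
    using assms by (auto simp: outliers_def)
  with assms(3) have "i \<noteq> j" by auto
  then have "1 \<le> \<bar>real i - real j\<bar>" by linarith
  then have "real m \<le> \<bar>real i - real j\<bar> * real m" by (simp add: mult_le_cancel_right1)
  also have "\<dots> = \<bar>real i * real m - real j * real m\<bar>"
    by (simp add: abs_mult flip: left_diff_distrib)
  finally show ?thesis unfolding * euclid_dist_plane_point by simp
qed

lemma opt_unr_chain_outliers: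
  assumes "m \<ge> 1" "k \<ge> 2"
  shows "real m / sqrt 2 \<le> opt_unr 2 k (chain m \<union> outliers m k)"
proof -
  let ?X = "chain m \<union> outliers m k"
  let ?C = "insert (chain m) ((\<lambda>x. {x}) ` outliers m k)"
  have fin: "finite ?X" by (simp add: chain_def outliers_def)
  have ne: "chain m \<noteq> {}" by (simp add: chain_def)
  have "outliers m k \<subset> ?X" "?X - outliers m k = chain m"
    using ne chain_outliers_disjoint[OF assms(1)] by blast+
  then have C: "is_clustering k ?X ?C"
    using is_clustering_singletons[OF fin, of "outliers m k"] card_outliers[OF assms(1), of k] assms(2)
    by simp
  have sq: "real m / sqrt 2 \<le> real m"
    by (simp add: divide_le_eq mult_le_cancel_left1)
  have "real m / sqrt 2 \<le> spacing 2 ?C"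
  proof (rule le_spacing[OF fin])
    fix A B x y assume *: "A \<in> ?C" "B \<in> ?C" "A \<noteq> B" "x \<in> A" "y \<in> B"
    then consider "x \<in> chain m" "y \<in> outliers m k" | "x \<in> outliers m k" "y \<in> chain m"
      | "x \<in> outliers m k" "y \<in> outliers m k" "x \<noteq> y" by auto
    then show "real m / sqrt 2 \<le> euclid_dist 2 x y"
    proof cases
      case 1
      then show ?thesis using outlier_dist_chain euclid_dist_commute by metis
    next
      case 2
      then show ?thesis using outlier_dist_chain by blast
    next
      case 3
      then show ?thesis using outlier_dist_outlier sq by fastforce
    qed
  qed (use C assms(2) in \<open>auto simp: is_clustering_def\<close>)
  also have "\<dots> \<le> opt_unr 2 k ?X"
    unfolding opt_unr_def using C by (intro Max_ge finite_clusterings fin) auto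
  finally show ?thesis .
qed

text \<open>Consecutive chain points are \<open>sqrt 2\<close> apart, so a larger spacing glues the
  chain together; the box property then adds the corner, and the remaining groups run out of
  points.\<close>

lemma spacing_explainable_chain_outliers:
  assumes "m \<ge> 1" "k \<ge> 2" and expl: "explainable 2 k (chain m \<union> outliers m k) \<C>"
  shows "spacing 2 \<C> \<le> sqrt 2"
proof (rule ccontr)
  let ?X = "chain m \<union> outliers m k" and ?P = "\<lambda>t. plane_point (real t) (real t)"
  let ?b = "plane_point (real m) 0"
  assume "\<not> ?thesis"
  then have large: "spacing 2 \<C> > sqrt 2" by simp
  have fin: "finite ?X" by (simp add: chain_def outliers_def)
  obtain t where part: "partition_on ?X \<C>" and card: "card \<C> = k"
    and t: "cuts_within 2 t" "set (leaf_groups ?X t) = \<C>"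
    using expl by (auto simp: explainable_def is_clustering_def)
  have PX: "?P s \<in> ?X" if "s \<le> m" for s using that by (auto simp: chain_def)
  obtain A where A: "A \<in> \<C>" "?P 0 \<in> A"
    using PX[of 0] partition_onD1[OF part] by blast
  have chain_in: "s \<le> m \<Longrightarrow> ?P s \<in> A" for s
  proof (induction s)
    case (Suc s)
    obtain B where B: "B \<in> \<C>" "?P (Suc s) \<in> B"
      using PX[OF Suc.prems] partition_onD1[OF part] by blast
    have "euclid_dist 2 (?P s) (?P (Suc s)) = sqrt 2"
      by (simp add: euclid_dist_plane_point)
    then have "A = B"
      using spacing_le[OF fin part A(1) B(1) _ _ B(2), of "?P s" 2] Suc large by fastforce
    with B show ?case by simp
  qed (use A in simp)
  have "?b \<in> outliers m k"
    unfolding outliers_def using assms(2) by (intro image_eqI[of _ _ 1]) auto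
  moreover have "?b \<in> A"
  proof (rule leaf_groups_box[OF t(1) _ A(2) chain_in])
    show "?b \<in> ?X" using \<open>?b \<in> outliers m k\<close> by blast
    show "A \<in> set (leaf_groups ?X t)" using t(2) A(1) by simp
    show "min (?P 0 i) (?P m i) \<le> ?b i \<and> ?b i \<le> max (?P 0 i) (?P m i)" if "i \<in> {1..2}" for i
      using that by (simp add: plane_point_def)
  qed simp
  \<comment> \<open>The inclusion is proper because of the corner: at most \<open>k - 2\<close>
    points are left for \<open>k - 1\<close> nonempty groups.\<close>
  ultimately have "?X - A \<subset> outliers m k"
    using chain_in by (auto simp: chain_def)
  then have "card (?X - A) < k - 1"
    using card_outliers[OF assms(1), of k] fin by (metis finite_Un psubset_card_mono)
  moreover have "card (\<C> - {A}) \<le> card (?X - A)"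
  proof -
    have "\<forall>B\<in>\<C> - {A}. \<exists>x. x \<in> B"
      using partition_onD3[OF part] by (metis DiffD1 all_not_in_conv)
    then obtain h where h: "\<And>B. B \<in> \<C> - {A} \<Longrightarrow> h B \<in> B" by metis
    have "inj_on h (\<C> - {A})"
    proof (rule inj_onI)
      fix B C assume "B \<in> \<C> - {A}" "C \<in> \<C> - {A}" "h B = h C"
      then show "B = C" using h[of B] h[of C] partition_on_same_group[OF part] by auto
    qed
    moreover have "h ` (\<C> - {A}) \<subseteq> ?X - A"
      using h A(1) partition_onD1[OF part] partition_on_same_group[OF part] by blast
    ultimately show ?thesis using fin card_inj_on_le by blast
  qed
  moreover have "card (\<C> - {A}) = k - 1"
    using A(1) card by simp
  ultimately show False by simp
qed

section \<open>Bounds on the price of explainability\<close>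

lemma price_lower_bound:
  assumes "2 \<le> k" "k < n"
  shows "ereal (1 / 2 * (real n - real k)) \<le> price_of_explainability n k"
proof -
  define m where "m = n - k"
  have m: "m \<ge> 1" "n = m + k" using assms by (auto simp: m_def)
  let ?X = "chain m \<union> outliers m k"
  have inst: "is_instance n 2 ?X"
    using is_instance_chain_outliers[OF m(1) assms(1)] m(2) by simp
  have pos: "0 < opt_exp 2 k ?X" by (rule opt_bounds(1)[OF inst assms])
  have fin: "finite ?X" by (simp add: chain_def outliers_def)
  have "\<exists>\<C>. is_clustering k ?X \<C>"
    using ex_clustering[OF fin, of k] inst assms by (simp add: is_instance_def)
  \<comment> \<open>The upper-bound construction supplies an explainable clustering, so
    \<open>opt_exp\<close> is the maximum of a nonempty set.\<close>
  then have "\<exists>\<D>. explainable 2 k ?X \<D>"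
    using ex_explainable_spacing[OF inst assms] by blast
  then have "opt_exp 2 k ?X \<le> sqrt 2"
    unfolding opt_exp_def using spacing_explainable_chain_outliers[OF m(1) assms(1)]
    by (subst Max_le_iff[OF finite_explainable[OF fin]]) auto
  \<comment> \<open>The constant \<open>1 / 2\<close> is the quotient of \<open>1 / sqrt 2\<close>,
    from the unrestricted spacing, by the bound \<open>sqrt 2\<close> on the explainable
    one.\<close>
  then have "1 / 2 * real m * opt_exp 2 k ?X \<le> 1 / 2 * real m * sqrt 2"
    by (intro mult_left_mono) auto
  also have "\<dots> = real m / sqrt 2" by (simp add: field_simps)
  also have "\<dots> \<le> opt_unr 2 k ?X" by (rule opt_unr_chain_outliers[OF m(1) assms(1)])
  finally have "1 / 2 * (real n - real k) \<le> opt_unr 2 k ?X / opt_exp 2 k ?X"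
    using pos m(2) by (simp add: le_divide_eq)
  moreover have "ereal (opt_unr 2 k ?X / opt_exp 2 k ?X) \<le> price_of_explainability n k"
    unfolding price_of_explainability_def using inst by (intro Sup_upper) blast
  ultimately show ?thesis by (meson ereal_less_eq(3) order_trans)
qed

lemma price_upper_bound:
  assumes "2 \<le> k" "k < n"
  shows "price_of_explainability n k \<le> ereal (2 * (real n - real k))"
  unfolding price_of_explainability_def
proof (rule Sup_least)
  fix y assume "y \<in> {ereal (opt_unr d k X / opt_exp d k X) | d X. is_instance n d X}"
  then obtain d X where "y = ereal (opt_unr d k X / opt_exp d k X)" "is_instance n d X" by blast
  with opt_bounds[OF this(2) assms] show "y \<le> ereal (2 * (real n - real k))"
    by (simp add: divide_le_eq)
qed

theorem theorem5:
  shows "\<exists>c C :: real. c > 0 \<and> C > 0 \<and>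
    (\<forall>k n :: nat. 2 \<le> k \<and> k < n \<longrightarrow>
       ereal (c * (real n - real k)) \<le> price_of_explainability n k \<and>
       price_of_explainability n k \<le> ereal (C * (real n - real k)))"
proof (intro exI conjI allI impI)
  show "(1 / 2 :: real) > 0" "(2 :: real) > 0" by simp_all
qed (use price_lower_bound price_upper_bound in blast)+

end
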